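(* For every prime $p$ and every integer $n \ge 2$, there exists a $d$-maximal finite $p$-group $G$ such that $|G:G'| = p^n$ and $|G'| = p^{n-2}$.
   Context: $G' = [G,G]$ denotes the derived subgroup of $G$, and $d(G)$ denotes the minimal size of a generating set of the finite group $G$. A finite group $G$ is called $d$-maximal if $d(H) < d(G)$ for every proper subgroup $H$ of $G$. *)

theory Defs
  imports "HOL-Computational_Algebra.Primes" "HOL-Algebra.Algebra"
begin

text \<open>Only meaningful for finitely generated groups; otherwise the \<open>LEAST\<close> is unspecified.\<close>

definition min_gen_card :: "('a, 'b) monoid_scheme \<Rightarrow> nat" where
  "min_gen_card G =
     (LEAST k. \<exists>S. S \<subseteq> carrier G \<and> finite S \<and> card S = k \<and> generate G S = carrier G)"

definition finite_p_group :: "nat \<Rightarrow> ('a, 'b) monoid_scheme \<Rightarrow> bool" where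
  "finite_p_group p G \<longleftrightarrow> group G \<and> finite (carrier G) \<and> (\<exists>k. order G = p ^ k)"

definition d_maximal :: "('a, 'b) monoid_scheme \<Rightarrow> bool" where
  "d_maximal G \<longleftrightarrow> group G \<and> finite (carrier G) \<and>
     (\<forall>H. subgroup H G \<and> H \<noteq> carrier G \<longrightarrow>
        min_gen_card (G\<lparr>carrier := H\<rparr>) < min_gen_card G)"

end

theory Submission
  imports Defs "HOL-Number_Theory.Cong"
begin

text \<open>
  Let \<open>A\<close> be the abelian group with generators \<open>v\<^sub>1\<close> of order \<open>p\<close> and \<open>v\<^sub>2, \<dots>, v\<^bsub>n-1\<^esub>\<close>
  of order \<open>p\<^sup>2\<close>, and let \<open>a\<close> of order \<open>p\<close> act on it by \<open>[a, v\<^sub>i] = v\<^bsub>i+1\<^esub>\<^sup>p\<close>, where \<open>v\<^sub>n = 1\<close>. In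
  \<open>G = A \<rtimes> \<langle>a\<rangle>\<close> the derived and the Frattini subgroup are both
  \<open>\<langle>v\<^sub>2\<^sup>p, \<dots>, v\<^bsub>n-1\<^esub>\<^sup>p\<rangle>\<close>, so \<open>d(G) = n\<close>.

  Now let \<open>H\<close> be a proper subgroup. If \<open>H \<le> A\<close>, then \<open>H\<close> is generated by \<open>n - 1\<close> elements.
  Otherwise \<open>H\<close> is generated by \<open>H \<inter> A\<close> and one element \<open>h\<close> outside \<open>A\<close>. Echelon generators of
  \<open>H \<inter> A\<close> can be taken as \<open>n - 2\<close> elements together with \<open>H \<inter> \<langle>v\<^sub>j\<rangle>\<close>, for any choice of \<open>j\<close>. If
  \<open>v\<^sub>1 \<notin> H\<close>, then \<open>j = 1\<close> makes the last part trivial. Otherwise take the least \<open>j\<close> with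
  \<open>v\<^sub>j \<notin> H\<close>: then \<open>H \<inter> \<langle>v\<^sub>j\<rangle> \<le> \<langle>v\<^sub>j\<^sup>p\<rangle>\<close>, and this group is generated by the commutator of \<open>h\<close>
  with \<open>v\<^bsub>j-1\<^esub> \<in> H\<close>, hence is redundant.
\<close>

section \<open>Minimal numbers of generators: bounds and invariance under isomorphism\<close>

text \<open>Generation by a subset of \<open>H\<close> means the same in \<open>H\<close> and in
  \<open>G\<close>, so bounds for subgroups can be found by computing in the ambient group
  only.\<close>

lemma (in group) min_gen_card_subgroup_le:
  assumes "subgroup H G" "finite S" "S \<subseteq> H" "H \<subseteq> generate G S"
  shows "min_gen_card (G\<lparr>carrier := H\<rparr>) \<le> card S"
proof -
  have "generate G S = H"
    using assms generate_subgroup_incl by blast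
  hence "generate (G\<lparr>carrier := H\<rparr>) S = H"
    using generate_consistent[OF assms(3,1)] by simp
  thus ?thesis
    unfolding min_gen_card_def using assms by (intro Least_le) auto
qed

lemma (in group) min_gen_card_ge:
  assumes "finite (carrier G)"
    and "\<And>S. S \<subseteq> carrier G \<Longrightarrow> generate G S = carrier G \<Longrightarrow> m \<le> card S"
  shows "m \<le> min_gen_card G"
proof -
  let ?P = "\<lambda>k. \<exists>S. S \<subseteq> carrier G \<and> finite S \<and> card S = k \<and> generate G S = carrier G"
  \<comment> \<open>The finite carrier is itself a generating set, so the \<open>LEAST\<close> in
    the definition is attained.\<close>
  have "generate G (carrier G) = carrier G"
    using generate_incl[of "carrier G"] generate.incl[of _ "carrier G" G] by blast
  hence "?P (card (carrier G))" using assms(1) by blast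
  hence "?P (min_gen_card G)" unfolding min_gen_card_def by (rule LeastI)
  then obtain S where "S \<subseteq> carrier G" "card S = min_gen_card G" "generate G S = carrier G"
    by auto
  thus ?thesis using assms(2)[of S] by simp
qed

lemma iso_min_gen_card:
  assumes "group G" "group H" "G \<cong> H"
  shows "min_gen_card G = min_gen_card H"
proof -
  \<comment> \<open>Transport in one direction, with types of its own, so that it applies both to
    the isomorphism and to its inverse.\<close>
  have *: "\<exists>S. S \<subseteq> carrier H \<and> finite S \<and> card S = k \<and> generate H S = carrier H"
    if GH: "group G" "group H" "\<phi> \<in> iso G H"
      and ex: "\<exists>S. S \<subseteq> carrier G \<and> finite S \<and> card S = k \<and> generate G S = carrier G"
    for G :: "('x, 'y) monoid_scheme" and H :: "('u, 'v) monoid_scheme" and \<phi> k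
  proof -
    interpret group_hom G H \<phi>
      using GH by (auto simp: group_hom_def group_hom_axioms_def iso_def)
    obtain S where S: "S \<subseteq> carrier G" "finite S" "card S = k" "generate G S = carrier G"
      using ex by blast
    have inj: "inj_on \<phi> (carrier G)" and im: "\<phi> ` carrier G = carrier H"
      using GH(3) by (auto simp: iso_def bij_betw_def)
    have "card (\<phi> ` S) = k"
      using S inj by (metis card_image inj_on_subset)
    moreover have "generate H (\<phi> ` S) = carrier H"
      using generate_img[OF S(1)] S(4) im by simp
    ultimately show ?thesis using S im by (intro exI[of _ "\<phi> ` S"]) auto
  qed
  obtain \<phi> where "\<phi> \<in> iso G H" using assms by (auto simp: is_iso_def)
  moreover obtain \<psi> where "\<psi> \<in> iso H G"
    using group.iso_sym[OF assms(1,3)] by (auto simp: is_iso_def)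
  ultimately show ?thesis
    unfolding min_gen_card_def
    by (intro arg_cong[where f = Least] ext iffI) (rule *[OF assms(1,2)] *[OF assms(2,1)], assumption+)+
qed

text \<open>A proper subgroup \<open>K\<close> of the target has a proper preimage \<open>H\<close>,
  and the isomorphism restricts to one from \<open>H\<close> onto \<open>K\<close>.\<close>

lemma iso_d_maximal:
  assumes "d_maximal G" "group G'" "\<phi> \<in> iso G G'"
  shows "d_maximal G'"
proof -
  have G: "group G" "finite (carrier G)" using assms by (auto simp: d_maximal_def)
  interpret \<phi>: group_hom G G' \<phi>
    using assms G unfolding group_hom_def group_hom_axioms_def iso_def by auto
  have inj: "inj_on \<phi> (carrier G)" and im: "\<phi> ` carrier G = carrier G'"
    using assms by (auto simp: iso_def bij_betw_def)
  have "min_gen_card (G'\<lparr>carrier := K\<rparr>) < min_gen_card G'"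
    if K: "subgroup K G'" "K \<noteq> carrier G'" for K
  proof -
    define H where "H = {x \<in> carrier G. \<phi> x \<in> K}"
    have H: "subgroup H G"
    proof (rule \<phi>.G.subgroupI)
      have "\<one>\<^bsub>G\<^esub> \<in> H" using K(1) by (simp add: H_def subgroup.one_closed)
      thus "H \<noteq> {}" by blast
    qed (use K(1) in \<open>auto simp: H_def subgroup.m_closed subgroup.m_inv_closed\<close>)
    have imH: "\<phi> ` H = K"
      using im subgroup.subset[OF K(1)] unfolding H_def by auto
    hence "H \<noteq> carrier G" using K(2) im by auto
    moreover have "G\<lparr>carrier := H\<rparr> \<cong> G'\<lparr>carrier := K\<rparr>"
    proof -
      have "\<phi> \<in> iso (G\<lparr>carrier := H\<rparr>) (G'\<lparr>carrier := K\<rparr>)"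
        using imH inj subgroup.subset[OF H]
        by (auto simp: iso_def hom_def bij_betw_def inj_on_def subset_iff H_def)
      thus ?thesis by (auto simp: is_iso_def)
    qed
    hence "min_gen_card (G\<lparr>carrier := H\<rparr>) = min_gen_card (G'\<lparr>carrier := K\<rparr>)"
      using iso_min_gen_card \<phi>.G.subgroup_imp_group[OF H] \<phi>.H.subgroup_imp_group[OF K(1)] by blast
    moreover have "min_gen_card G = min_gen_card G'"
      using iso_min_gen_card[OF G(1) assms(2)] assms(3) by (auto simp: is_iso_def)
    ultimately show ?thesis using assms(1) H by (auto simp: d_maximal_def)
  qed
  moreover have "finite (carrier G')" using G(2) im by (metis finite_imageI)
  ultimately show ?thesis using assms(2) by (auto simp: d_maximal_def)
qed

text \<open>Transport of structure along an injection into \<open>nat\<close>. The group is built on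
  functions, whereas the theorem asks for a group of natural numbers.\<close>

lemma (in group) finite_iso_nat:
  assumes "finite (carrier G)"
  obtains G' :: "nat monoid" and \<phi> where "group G'" "\<phi> \<in> iso G G'"
proof -
  obtain \<phi> :: "'a \<Rightarrow> nat" where inj: "inj_on \<phi> (carrier G)"
    using finite_imp_inj_to_nat_seg[OF assms] by blast
  define \<psi> where "\<psi> = inv_into (carrier G) \<phi>"
  have \<psi>[simp]: "\<psi> (\<phi> x) = x" if "x \<in> carrier G" for x
    using that inj by (simp add: \<psi>_def)
  define G' where "G' = \<lparr>carrier = \<phi> ` carrier G, monoid.mult = \<lambda>x y. \<phi> (\<psi> x \<otimes> \<psi> y), one = \<phi> \<one>\<rparr>"
  have "group G'"
  proof (rule groupI)
    fix x assume "x \<in> carrier G'"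
    thus "\<exists>y\<in>carrier G'. y \<otimes>\<^bsub>G'\<^esub> x = \<one>\<^bsub>G'\<^esub>"
      by (auto simp: G'_def intro!: bexI[of _ "inv _"])
  qed (auto simp: G'_def m_assoc)
  moreover have "\<phi> \<in> iso G G'"
    using inj by (auto simp: iso_def hom_def bij_betw_def G'_def)
  ultimately show ?thesis using that by blast
qed

section \<open>Tools for generating sets and for counting\<close>

text \<open>The image of \<open>H\<close> in the integers modulo \<open>m\<close> is cyclic, so one
  element \<open>h\<close> together with the kernel generates \<open>H\<close>.\<close>

lemma (in group) generate_cyclic_quotient:
  fixes \<phi> :: "'a \<Rightarrow> int"
  assumes H: "subgroup H G" and "m > 0"
    and hom: "\<And>x y. x \<in> H \<Longrightarrow> y \<in> H \<Longrightarrow> [\<phi> (x \<otimes> y) = \<phi> x + \<phi> y] (mod m)"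
  obtains h where "h \<in> H" "H \<subseteq> generate G (insert h {x \<in> H. m dvd \<phi> x})"
proof (cases "\<exists>x\<in>H. \<not> m dvd \<phi> x")
  case False
  have "\<one> \<in> H" using H by (rule subgroup.one_closed)
  moreover have "H \<subseteq> generate G (insert \<one> {x \<in> H. m dvd \<phi> x})"
    using False by (auto intro: generate.incl)
  ultimately show ?thesis using that by blast
next
  case True
  \<comment> \<open>\<open>h\<close> has the least positive residue. If everything lay in the
    kernel, the neutral element would do, as in the previous case.\<close>
  define h where "h = arg_min (\<lambda>x. nat (\<phi> x mod m)) (\<lambda>x. x \<in> H \<and> \<not> m dvd \<phi> x)"
  have h: "h \<in> H" "\<not> m dvd \<phi> h"
    and min: "\<And>x. x \<in> H \<Longrightarrow> \<not> m dvd \<phi> x \<Longrightarrow> nat (\<phi> h mod m) \<le> nat (\<phi> x mod m)"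
    using arg_min_nat_lemma[of "\<lambda>x. x \<in> H \<and> \<not> m dvd \<phi> x" _ "\<lambda>x. nat (\<phi> x mod m)"] True
    unfolding h_def by blast+
  have HG: "x \<in> carrier G" if "x \<in> H" for x using H that by (rule subgroup.mem_carrier)
  have cl: "x \<otimes> y \<in> H" if "x \<in> H" "y \<in> H" for x y using H that by (rule subgroup.m_closed)
  have one: "\<one> \<in> H" using H by (rule subgroup.one_closed)
  have \<phi>1: "[\<phi> \<one> = 0] (mod m)"
    using hom[OF one one] by (simp add: cong_iff_dvd_diff)
  have pow: "h [^] k \<in> H \<and> [\<phi> (h [^] k) = int k * \<phi> h] (mod m)" for k :: nat
  proof (induction k)
    case 0 thus ?case using one \<phi>1 by simp
  next
    case (Suc k)
    have "[\<phi> (h [^] k \<otimes> h) = \<phi> (h [^] k) + \<phi> h] (mod m)" using Suc h hom by blast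
    also have "[\<phi> (h [^] k) + \<phi> h = int k * \<phi> h + \<phi> h] (mod m)"
      using Suc by (intro cong_add) auto
    finally show ?case using Suc h cl by (simp add: algebra_simps)
  qed
  have "x \<in> generate G (insert h {x \<in> H. m dvd \<phi> x})" if x: "x \<in> H" for x
  proof -
    define a where "a = \<phi> h mod m"
    \<comment> \<open>Division with remainder by \<open>a\<close>: the residue of \<open>y\<close>
      below is the remainder, hence smaller than \<open>a\<close>, and minimality of
      \<open>a\<close> puts \<open>y\<close> into the kernel.\<close>
    define k where "k = nat ((\<phi> x mod m) div a)"
    have a: "a > 0" "a < m"
      using h(2) \<open>m > 0\<close> pos_mod_sign[of m "\<phi> h"] pos_mod_bound[of m "\<phi> h"]
      unfolding a_def dvd_eq_mod_eq_0 by linarith+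
    define y where "y = x \<otimes> inv (h [^] k)"
    have y: "y \<in> H" using x pow cl subgroup.m_inv_closed[OF H] by (simp add: y_def)
    have xy: "x = y \<otimes> h [^] k"
      using x h HG by (simp add: y_def m_assoc)
    have "int k = (\<phi> x mod m) div a"
      using a \<open>m > 0\<close> by (simp add: k_def pos_imp_zdiv_nonneg_iff)
    hence ra: "\<phi> x mod m - int k * a = (\<phi> x mod m) mod a"
      by (simp add: minus_div_mult_eq_mod)
    have "[\<phi> x = \<phi> y + \<phi> (h [^] k)] (mod m)" using hom[of y "h [^] k"] y pow xy by simp
    also have "[\<phi> y + \<phi> (h [^] k) = \<phi> y + int k * a] (mod m)"
      using pow[of k] unfolding a_def
      by (intro cong_add cong_refl) (simp add: cong_def mod_mult_right_eq)
    finally have "[\<phi> y = \<phi> x - int k * a] (mod m)"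
      by (simp add: cong_iff_dvd_diff algebra_simps dvd_diff_commute)
    also have "[\<phi> x - int k * a = \<phi> x mod m - int k * a] (mod m)"
      by (intro cong_diff) (auto simp: cong_def)
    finally have "\<phi> y mod m = ((\<phi> x mod m) mod a) mod m"
      using ra by (simp add: cong_def)
    also have "\<dots> = (\<phi> x mod m) mod a"
      using a pos_mod_bound[OF a(1), of "\<phi> x mod m"] pos_mod_sign[OF a(1), of "\<phi> x mod m"]
      by (intro mod_pos_pos_trivial) linarith+
    also have "\<dots> < a" using a(1) by (rule pos_mod_bound)
    finally have "\<not> nat (\<phi> h mod m) \<le> nat (\<phi> y mod m)"
      using a by (simp add: a_def nat_le_eq_zle)
    hence "m dvd \<phi> y"
      using min[OF y] by blast
    hence "y \<in> generate G (insert h {x \<in> H. m dvd \<phi> x})"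
      using y by (intro generate.incl) auto
    moreover have "h [^] k \<in> generate G (insert h {x \<in> H. m dvd \<phi> x})"
    proof (induction k)
      case (Suc k) thus ?case by (auto intro: generate.eng generate.incl)
    qed (auto intro: generate.one)
    ultimately show ?thesis by (subst xy) (rule generate.eng)
  qed
  hence "H \<subseteq> generate G (insert h {x \<in> H. m dvd \<phi> x})" by (rule subsetI)
  with h(1) show ?thesis by (rule that)
qed

text \<open>In a product, the central factors from \<open>D\<close> can all be moved to the right
  and collected there.\<close>

lemma (in group) generate_Un_central:
  assumes T: "T \<subseteq> carrier G" and D: "subgroup D G"
    and central: "\<And>d x. d \<in> D \<Longrightarrow> x \<in> carrier G \<Longrightarrow> d \<otimes> x = x \<otimes> d"
    and x: "x \<in> generate G (T \<union> D)"
  obtains t d where "t \<in> generate G T" "d \<in> D" "x = t \<otimes> d"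
proof -
  have DG: "d \<in> carrier G" if "d \<in> D" for d using D that by (rule subgroup.mem_carrier)
  have TG: "t \<in> carrier G" if "t \<in> generate G T" for t using generate_in_carrier[OF T that] .
  have one: "\<one> \<in> D" using D by (rule subgroup.one_closed)
  have "\<exists>t\<in>generate G T. \<exists>d\<in>D. x = t \<otimes> d"
    using x
  proof (induction rule: generate.induct)
    case one
    show ?case using generate.one[of G T] \<open>\<one> \<in> D\<close> by force
  next
    case (incl x)
    thus ?case
    proof
      assume "x \<in> T"
      thus ?thesis using generate.incl[of x T G] one T by force
    next
      assume "x \<in> D"
      thus ?thesis using generate.one[of G T] DG by force
    qed
  next
    case (inv x)
    thus ?case
    proof
      assume "x \<in> T"
      thus ?thesis using generate.inv[of x T G] one T by force
    next
      assume "x \<in> D"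
      thus ?thesis using generate.one[of G T] DG subgroup.m_inv_closed[OF D] by force
    qed
  next
    case (eng x y)
    then obtain t d t' d' where
      *: "t \<in> generate G T" "d \<in> D" "x = t \<otimes> d" "t' \<in> generate G T" "d' \<in> D" "y = t' \<otimes> d'"
      by blast
    have "x \<otimes> y = t \<otimes> (d \<otimes> t') \<otimes> d'" using * DG TG by (simp add: m_assoc)
    also have "\<dots> = (t \<otimes> t') \<otimes> (d \<otimes> d')" using * DG TG by (simp add: central[of d t'] m_assoc)
    finally show ?case
      using * generate.eng[of t G T t'] subgroup.m_closed[OF D] by blast
  qed
  thus ?thesis using that by blast
qed

text \<open>Restriction to the indices below \<open>n\<close> is a bijection onto an extensional
  product, because all other values are prescribed.\<close>

lemma finite_card_functions:
  fixes B :: "nat \<Rightarrow> 'a set"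
  assumes "\<And>k. k < n \<Longrightarrow> finite (B k)"
  shows "finite {f. (\<forall>k<n. f k \<in> B k) \<and> (\<forall>k\<ge>n. f k = c)}" (is "finite ?F")
    and "card {f. (\<forall>k<n. f k \<in> B k) \<and> (\<forall>k\<ge>n. f k = c)} = (\<Prod>k<n. card (B k))"
proof -
  have bij: "bij_betw (\<lambda>f. restrict f {..<n}) ?F (PiE {..<n} B)"
    by (rule bij_betwI[where g = "\<lambda>f k. if k < n then f k else c"])
       (auto simp: fun_eq_iff PiE_def extensional_def)
  show "finite ?F"
    using bij_betw_finite[OF bij] assms by (auto intro: finite_PiE)
  show "card ?F = (\<Prod>k<n. card (B k))"
    using bij_betw_same_card[OF bij] by (simp add: card_PiE)
qed

section \<open>Construction of the group\<close>

locale shift_extension =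
  fixes p n :: nat
  assumes prime_p: "Factorial_Ring.prime p" and two_le_n: "2 \<le> n"
begin

text \<open>
  The element \<open>v\<^sub>1\<^bsup>f 1\<^esup> \<cdots> v\<^bsub>n-1\<^esub>\<^bsup>f (n-1)\<^esup> a\<^bsup>f 0\<^esup>\<close> is encoded as the function \<open>f\<close>, with the
  \<open>k\<close>-th coordinate reduced modulo \<open>q k\<close>. The modulus \<open>1\<close> forces the coordinates from \<open>n\<close> on to
  be \<open>0\<close>, which also truncates \<open>shift\<close>.
\<close>

definition q :: "nat \<Rightarrow> int" where
  "q k = (if k < 2 then int p else if k < n then (int p)\<^sup>2 else 1)"

definition shift :: "(nat \<Rightarrow> int) \<Rightarrow> nat \<Rightarrow> int" where
  "shift f k = (if k < 2 then 0 else int p * f (k - 1))"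

definition mul :: "(nat \<Rightarrow> int) \<Rightarrow> (nat \<Rightarrow> int) \<Rightarrow> nat \<Rightarrow> int" where
  "mul f g k = (f k + g k + f 0 * shift g k) mod q k"

definition G :: "(nat \<Rightarrow> int) monoid" where
  "G = \<lparr>carrier = {f. \<forall>k. f k \<in> {0..<q k}}, monoid.mult = mul, one = \<lambda>_. 0\<rparr>"

lemma p_gt_1: "int p > 1"
  using prime_p prime_gt_1_nat by simp

lemma q_pos [simp]: "q k > 0"
  using p_gt_1 by (simp add: q_def)

lemma p_dvd_q: "k < n \<Longrightarrow> int p dvd q k"
  by (simp add: q_def)

lemma q_dvd_p2: "q k dvd (int p)\<^sup>2"
  by (simp add: q_def)

lemma q_0 [simp]: "q 0 = int p" and q_Suc_0 [simp]: "q (Suc 0) = int p"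
  by (simp_all add: q_def)

lemma q_ge_n: "k \<ge> n \<Longrightarrow> q k = 1"
  using two_le_n by (simp add: q_def)

lemma mem_carrier: "f \<in> carrier G \<longleftrightarrow> (\<forall>k. 0 \<le> f k \<and> f k < q k)"
  by (simp add: G_def)

lemma one_G [simp]: "\<one>\<^bsub>G\<^esub> = (\<lambda>_. 0)"
  by (simp add: G_def)

lemma mult_G: "f \<otimes>\<^bsub>G\<^esub> g = mul f g"
  by (simp add: G_def)

text \<open>Coordinates are reduced residues; this lets identities in the group be checked as
  congruences.\<close>

lemma carrier_eqI:
  assumes "f \<in> carrier G" "g \<in> carrier G" "\<And>k. [f k = g k] (mod q k)"
  shows "f = g"
  using assms by (auto simp: mem_carrier intro!: ext cong_less_imp_eq_int)

lemma carrier_ge_n: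
  assumes "f \<in> carrier G" "k \<ge> n"
  shows "f k = 0"
proof -
  have "0 \<le> f k \<and> f k < 1" using assms by (metis mem_carrier q_ge_n)
  thus ?thesis by simp
qed

lemma q_dvd_coord: "f \<in> carrier G \<Longrightarrow> q k dvd f k \<Longrightarrow> f k = 0"
  unfolding mem_carrier by (metis zdvd_not_zless order_le_less)

lemma mul_closed [simp]: "mul f g \<in> carrier G"
  by (simp add: mem_carrier mul_def)

lemma mul_cong: "[mul f g k = f k + g k + f 0 * shift g k] (mod q k)"
  by (simp add: mul_def cong_def)

lemma shift_0 [simp]: "shift f 0 = 0" and shift_Suc_0 [simp]: "shift f (Suc 0) = 0"
  by (simp_all add: shift_def)

lemma p_dvd_shift: "int p dvd shift f k"
  by (simp add: shift_def)

text \<open>\<open>shift\<close> contributes a factor p and \<open>q k\<close> divides p^2, so the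
  coefficient counts only modulo p. This is why the acting element has order p.\<close>

lemma coeff_shift_cong:
  assumes "[x = y] (mod int p)"
  shows "[x * shift f k = y * shift f k] (mod q k)"
proof -
  have "int p * int p dvd (x - y) * shift f k"
    using assms p_dvd_shift by (intro mult_dvd_mono) (auto simp: cong_iff_dvd_diff)
  hence "q k dvd (x - y) * shift f k"
    using q_dvd_p2[of k] by (simp add: power2_eq_square) (metis dvd_trans)
  thus ?thesis by (simp add: cong_iff_dvd_diff algebra_simps)
qed

lemma p_mult_cong_q:
  assumes "[x = y] (mod int p)"
  shows "[int p * x = int p * y] (mod q j)"
proof -
  have "int p * int p dvd int p * (x - y)"
    using assms by (intro mult_dvd_mono) (auto simp: cong_iff_dvd_diff)
  hence "q j dvd int p * (x - y)"
    using q_dvd_p2[of j] by (simp only: power2_eq_square) (metis dvd_trans)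
  thus ?thesis by (simp add: cong_iff_dvd_diff algebra_simps)
qed

text \<open>The factor p in \<open>shift\<close> turns a congruence modulo p into one modulo p^2;
  from \<open>n\<close> on the modulus is 1.\<close>

lemma shift_cong:
  assumes "\<And>i. i < n \<Longrightarrow> [f i = g i] (mod int p)"
  shows "[shift f k = shift g k] (mod q k)"
proof (cases "k < n")
  case True
  thus ?thesis using assms[of "k - 1"] by (simp add: shift_def p_mult_cong_q)
qed (simp add: q_ge_n)

text \<open>The twist is divisible by p. Hence reduction of the first \<open>n\<close> coordinates
  modulo p is a homomorphism to an elementary abelian group.\<close>

lemma mul_cong_p:
  assumes "k < n"
  shows "[mul f g k = f k + g k] (mod int p)"
proof -
  have "[mul f g k = f k + g k + f 0 * shift g k] (mod int p)"
    using mul_cong p_dvd_q[OF assms] by (rule cong_dvd_modulus)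
  also have "[f k + g k + f 0 * shift g k = f k + g k + f 0 * 0] (mod int p)"
    using p_dvd_shift by (intro cong_add cong_mult cong_refl) (simp add: cong_0_iff)
  finally show ?thesis by simp
qed

text \<open>The coefficient \<open>mul f g 0\<close> and the argument \<open>mul g h\<close> of
  \<open>shift\<close> count only modulo p, where both are plain sums. So no double shift survives,
  and both sides agree by bilinearity.\<close>

lemma mul_assoc: "mul (mul f g) h = mul f (mul g h)"
proof (rule carrier_eqI)
  fix k
  have "[mul (mul f g) h k = mul f g k + h k + mul f g 0 * shift h k] (mod q k)"
    by (rule mul_cong)
  also have "[mul f g k + h k + mul f g 0 * shift h k
      = (f k + g k + f 0 * shift g k) + h k + (f 0 + g 0) * shift h k] (mod q k)"
    using two_le_n by (intro cong_add mul_cong coeff_shift_cong mul_cong_p cong_refl) simp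
  also have "(f k + g k + f 0 * shift g k) + h k + (f 0 + g 0) * shift h k
      = f k + (g k + h k + g 0 * shift h k) + f 0 * shift (\<lambda>i. g i + h i) k"
    by (simp add: shift_def algebra_simps)
  also have "[f k + (g k + h k + g 0 * shift h k) + f 0 * shift (\<lambda>i. g i + h i) k
      = f k + mul g h k + f 0 * shift (mul g h) k] (mod q k)"
    by (intro cong_add cong_mult cong_refl cong_sym[OF mul_cong] shift_cong cong_sym[OF mul_cong_p])
  also have "[f k + mul g h k + f 0 * shift (mul g h) k = mul f (mul g h) k] (mod q k)"
    by (rule cong_sym[OF mul_cong])
  finally show "[mul (mul f g) h k = mul f (mul g h) k] (mod q k)" .
qed simp_all

text \<open>The solution \<open>g\<close> of \<open>g k + f k + g 0 * shift f k = 0\<close>, into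
  which \<open>g 0 = - f 0\<close> has been substituted.\<close>

definition inverse_elem :: "(nat \<Rightarrow> int) \<Rightarrow> nat \<Rightarrow> int" where
  "inverse_elem f k = (f 0 * shift f k - f k) mod q k"

lemma inverse_elem_closed: "inverse_elem f \<in> carrier G"
  by (simp add: mem_carrier inverse_elem_def)

lemma one_closed: "(\<lambda>_. 0) \<in> carrier G"
  by (simp add: mem_carrier)

lemma mul_inverse_elem: "mul (inverse_elem f) f = (\<lambda>_. 0)"
proof (rule carrier_eqI)
  fix k
  have "[mul (inverse_elem f) f k
      = inverse_elem f k + f k + inverse_elem f 0 * shift f k] (mod q k)"
    by (rule mul_cong)
  also have "[inverse_elem f k + f k + inverse_elem f 0 * shift f k
      = (f 0 * shift f k - f k) + f k + (- f 0) * shift f k] (mod q k)"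
    by (intro cong_add coeff_shift_cong cong_refl) (simp_all add: inverse_elem_def cong_def)
  finally show "[mul (inverse_elem f) f k = 0] (mod q k)" by simp
qed (simp_all add: one_closed)

sublocale group G
proof (rule groupI)
  fix f assume f: "f \<in> carrier G"
  show "\<one>\<^bsub>G\<^esub> \<otimes>\<^bsub>G\<^esub> f = f"
    using f by (auto simp: mult_G mul_def mem_carrier)
  show "\<exists>g\<in>carrier G. g \<otimes>\<^bsub>G\<^esub> f = \<one>\<^bsub>G\<^esub>"
    using inverse_elem_closed mul_inverse_elem by (auto simp: mult_G)
qed (auto simp: mult_G mul_assoc one_closed)

lemma inv_G: "f \<in> carrier G \<Longrightarrow> inv\<^bsub>G\<^esub> f = inverse_elem f"
  using inverse_elem_closed mul_inverse_elem by (intro inv_equality) (auto simp: mult_G)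

lemma inv_cong_p:
  assumes "f \<in> carrier G" "k < n"
  shows "[(inv\<^bsub>G\<^esub> f) k = - f k] (mod int p)"
proof -
  have "[mul (inv\<^bsub>G\<^esub> f) f k = (inv\<^bsub>G\<^esub> f) k + f k] (mod int p)"
    by (rule mul_cong_p[OF assms(2)])
  moreover have "mul (inv\<^bsub>G\<^esub> f) f k = 0"
    using l_inv[OF assms(1)] by (simp add: mult_G)
  ultimately have "[(inv\<^bsub>G\<^esub> f) k + f k = 0] (mod int p)"
    by (metis cong_sym)
  thus ?thesis by (simp add: cong_iff_dvd_diff)
qed

section \<open>Echelon generators for subgroups of the base group A\<close>

text \<open>The coefficient of the twist is coordinate 0 of the left factor, which vanishes
  here.\<close>

lemma mult_base:
  assumes "f 0 = 0"
  shows "[(f \<otimes>\<^bsub>G\<^esub> g) k = f k + g k] (mod q k)"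
  using mul_cong[of f g k] assms by (simp add: mult_G)

lemma subgroup_coords_eq_0:
  assumes "subgroup B G" "\<And>f. f \<in> B \<Longrightarrow> f 0 = 0"
  shows "subgroup {f \<in> B. \<forall>i\<in>I. f i = 0} G"
proof (rule subgroupI)
  show "{f \<in> B. \<forall>i\<in>I. f i = 0} \<noteq> {}"
    using subgroup.one_closed[OF assms(1)] by auto
  show "{f \<in> B. \<forall>i\<in>I. f i = 0} \<subseteq> carrier G"
    using subgroup.subset[OF assms(1)] by auto
next
  fix f assume f: "f \<in> {f \<in> B. \<forall>i\<in>I. f i = 0}"
  hence "f \<in> carrier G" using subgroup.subset[OF assms(1)] by auto
  moreover have "f 0 = 0" using f assms(2) by blast
  ultimately show "inv\<^bsub>G\<^esub> f \<in> {f \<in> B. \<forall>i\<in>I. f i = 0}"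
    using f subgroup.m_inv_closed[OF assms(1), of f]
    by (simp add: inv_G inverse_elem_def)
next
  fix f g assume fg: "f \<in> {f \<in> B. \<forall>i\<in>I. f i = 0}" "g \<in> {f \<in> B. \<forall>i\<in>I. f i = 0}"
  moreover have "f 0 = 0" using fg assms(2) by blast
  ultimately show "f \<otimes>\<^bsub>G\<^esub> g \<in> {f \<in> B. \<forall>i\<in>I. f i = 0}"
    using subgroup.m_closed[OF assms(1), of f g] by (auto simp: mult_G mul_def)
qed

lemma subgroup_0_coord:
  assumes H: "subgroup H G"
  shows "subgroup {f \<in> H. f 0 = 0} G"
proof (rule subgroupI)
  show "{f \<in> H. f 0 = 0} \<noteq> {}"
    using subgroup.one_closed[OF H] by auto
  show "{f \<in> H. f 0 = 0} \<subseteq> carrier G"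
    using subgroup.subset[OF H] by auto
next
  fix f assume f: "f \<in> {f \<in> H. f 0 = 0}"
  hence "f \<in> carrier G" using subgroup.subset[OF H] by auto
  thus "inv\<^bsub>G\<^esub> f \<in> {f \<in> H. f 0 = 0}"
    using f subgroup.m_inv_closed[OF H, of f] by (simp add: inv_G inverse_elem_def)
next
  fix f g assume "f \<in> {f \<in> H. f 0 = 0}" "g \<in> {f \<in> H. f 0 = 0}"
  thus "f \<otimes>\<^bsub>G\<^esub> g \<in> {f \<in> H. f 0 = 0}"
    using subgroup.m_closed[OF H, of f g] by (simp add: mult_G mul_def)
qed

text \<open>Elimination of one coordinate after the other: coordinate \<open>i\<close> maps the
  current subgroup to a cyclic group, which costs one generator and leaves the kernel.\<close>

lemma generators_modulo_coords:
  assumes B: "subgroup B G" "\<And>f. f \<in> B \<Longrightarrow> f 0 = 0" and "finite I"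
  shows "\<exists>T\<subseteq>B. finite T \<and> card T \<le> card I \<and>
           B \<subseteq> generate G (T \<union> {f \<in> B. \<forall>i\<in>I. f i = 0})"
  using \<open>finite I\<close>
proof induction
  case empty
  show ?case by (intro exI[of _ "{}"]) (auto intro: generate.incl)
next
  case (insert i I)
  let ?B = "\<lambda>I. {f \<in> B. \<forall>i\<in>I. f i = 0}"
  have sub: "subgroup (?B I) G" using B by (rule subgroup_coords_eq_0)
  obtain T where T: "T \<subseteq> B" "finite T" "card T \<le> card I" "B \<subseteq> generate G (T \<union> ?B I)"
    using insert.IH by blast
  obtain h where h: "h \<in> ?B I" "?B I \<subseteq> generate G (insert h {f \<in> ?B I. q i dvd f i})"
  proof (rule generate_cyclic_quotient[OF sub q_pos[of i], of "\<lambda>f. f i"])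
    fix f g assume "f \<in> ?B I"
    thus "[(f \<otimes>\<^bsub>G\<^esub> g) i = f i + g i] (mod q i)" using B(2) by (intro mult_base) auto
  qed
  have BG: "B \<subseteq> carrier G" using B(1) by (rule subgroup.subset)
  \<comment> \<open>A reduced coordinate divisible by its modulus is 0, so the kernel lies in the
    next subgroup of the chain.\<close>
  have "{f \<in> ?B I. q i dvd f i} \<subseteq> ?B (insert i I)"
    using q_dvd_coord BG by auto
  hence "?B I \<subseteq> generate G (insert h T \<union> ?B (insert i I))"
    using h(2) mono_generate[of "insert h {f \<in> ?B I. q i dvd f i}" "insert h T \<union> ?B (insert i I)"]
    by blast
  moreover have "T \<subseteq> generate G (insert h T \<union> ?B (insert i I))"
    by (auto intro: generate.incl)
  moreover have "subgroup (generate G (insert h T \<union> ?B (insert i I))) G"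
    using h(1) T(1) BG by (intro generate_is_subgroup) auto
  ultimately have "generate G (T \<union> ?B I) \<subseteq> generate G (insert h T \<union> ?B (insert i I))"
    by (intro generate_subgroup_incl) auto
  moreover have "card (insert h T) \<le> card (insert i I)"
    using T insert.hyps by (simp add: card_insert_if)
  ultimately show ?case
    using T h(1) by (intro exI[of _ "insert h T"]) auto
qed

section \<open>Powers of the standard generators and their commutators\<close>

text \<open>This is v_j^c for \<open>1 \<le> j\<close> and \<open>j < n\<close>, a^c for
  \<open>j = 0\<close>, and trivial for \<open>j \<ge> n\<close>, where the modulus is 1.\<close>

definition e :: "nat \<Rightarrow> int \<Rightarrow> nat \<Rightarrow> int" where
  "e j c i = (if i = j then c mod q j else 0)"

lemma e_closed [simp]: "e j c \<in> carrier G"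
  by (simp add: mem_carrier e_def)

lemma e_0 [simp]: "j \<ge> 1 \<Longrightarrow> e j c 0 = 0"
  by (simp add: e_def)

lemma e_cong: "[c = d] (mod q j) \<Longrightarrow> e j c = e j d"
  by (auto simp: e_def cong_def)

lemma e_zero [simp]: "e j 0 = (\<lambda>_. 0)"
  by (auto simp: e_def)

lemma e_mult:
  assumes "j \<ge> 1"
  shows "e j c \<otimes>\<^bsub>G\<^esub> e j d = e j (c + d)"
proof (rule carrier_eqI)
  fix k
  show "[(e j c \<otimes>\<^bsub>G\<^esub> e j d) k = e j (c + d) k] (mod q k)"
    using mult_base[of "e j c" "e j d" k] assms
    by (auto simp: e_def cong_def mod_simps)
qed (simp_all add: mult_G)

lemma e_pow:
  assumes "j \<ge> 1"
  shows "e j c [^]\<^bsub>G\<^esub> (m :: nat) = e j (c * int m)"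
  using assms by (induction m) (simp_all add: e_mult algebra_simps)

lemma subgroup_pow_closed:
  assumes "subgroup H G" "f \<in> H"
  shows "f [^]\<^bsub>G\<^esub> (m :: nat) \<in> H"
  using subgroup_int_pow_closed[OF assms, of "int m"] by (simp add: int_pow_int)

lemma e_multiple_mem:
  assumes H: "subgroup H G" "e j c \<in> H" and "j \<ge> 1" and "[c * x = d] (mod q j)"
  shows "e j d \<in> H"
proof -
  define m where "m = nat (x mod q j)"
  have "[d = c * x] (mod q j)" using assms(4) by (rule cong_sym)
  also have "[c * x = c * int m] (mod q j)"
    by (simp add: m_def cong_def mod_mult_right_eq)
  finally have "e j d = e j c [^]\<^bsub>G\<^esub> m"
    using e_pow[OF \<open>j \<ge> 1\<close>, of c m] by (simp add: e_cong)
  thus ?thesis using subgroup_pow_closed[OF H] by simp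
qed

text \<open>An element of the base group is the product of the factors \<open>e j (f j)\<close>; the
  truncations \<open>r m\<close> are its partial products.\<close>

lemma mem_of_coords_mem:
  assumes H: "subgroup H G" and f: "f \<in> carrier G" "f 0 = 0"
    and e: "\<And>j. 1 \<le> j \<Longrightarrow> j < n \<Longrightarrow> e j (f j) \<in> H"
  shows "f \<in> H"
proof -
  define r where "r m = (\<lambda>i. if i < m then f i else 0)" for m
  have r_closed: "r m \<in> carrier G" for m using f by (auto simp: r_def mem_carrier)
  have "r m \<in> H" for m
  proof (induction m)
    case 0 thus ?case using subgroup.one_closed[OF H] by (simp add: r_def)
  next
    case (Suc m)
    consider "m = 0" | "m \<ge> n" | "1 \<le> m" "m < n" by linarith
    thus ?case
    proof cases
      case 1
      hence "r (Suc m) = r m" using f by (auto simp: r_def)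
      thus ?thesis using Suc by simp
    next
      case 2
      hence "r (Suc m) = r m" using carrier_ge_n[OF f(1)] by (auto simp: r_def fun_eq_iff less_Suc_eq)
      thus ?thesis using Suc by simp
    next
      case 3
      have "r m \<otimes>\<^bsub>G\<^esub> e m (f m) = r (Suc m)"
      proof (rule carrier_eqI)
        fix k
        have "[(r m \<otimes>\<^bsub>G\<^esub> e m (f m)) k = r m k + e m (f m) k] (mod q k)"
          using f by (intro mult_base) (auto simp: r_def)
        also have "[r m k + e m (f m) k = r (Suc m) k] (mod q k)"
          by (auto simp: r_def e_def cong_def)
        finally show "[(r m \<otimes>\<^bsub>G\<^esub> e m (f m)) k = r (Suc m) k] (mod q k)" .
      qed (simp_all add: r_closed mult_G)
      thus ?thesis using Suc e[OF 3] subgroup.m_closed[OF H] by metis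
    qed
  qed
  moreover have "r n = f" using carrier_ge_n[OF f(1)] by (auto simp: r_def)
  ultimately show ?thesis by metis
qed

text \<open>The defining relation for the commutator of a with v_i, extended to arbitrary
  \<open>h\<close>: as the base group is abelian, only \<open>h 0\<close> enters.\<close>

lemma mult_e_commute:
  assumes i: "i \<ge> 1" and h: "h \<in> carrier G"
  shows "h \<otimes>\<^bsub>G\<^esub> e i c = e (Suc i) (int p * h 0 * c) \<otimes>\<^bsub>G\<^esub> (e i c \<otimes>\<^bsub>G\<^esub> h)"
proof (rule carrier_eqI)
  fix k
  \<comment> \<open>\<open>e\<close> reduces \<open>c\<close> modulo \<open>q i\<close>. Since p
    divides \<open>q i\<close> for \<open>i < n\<close>, this is harmless after multiplication by
    p.\<close>
  have sh: "[shift (e i c) k = e (Suc i) (int p * c) k] (mod q k)"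
  proof (cases "k = Suc i \<and> k < n")
    case True
    hence "int p dvd q i" by (intro p_dvd_q) auto
    hence "[c mod q i = c] (mod int p)"
      by (simp add: cong_def mod_mod_cancel)
    hence "[int p * (c mod q i) = int p * c] (mod q k)" by (rule p_mult_cong_q)
    thus ?thesis using True i by (simp add: shift_def e_def cong_def)
  next
    case False
    thus ?thesis using i by (cases "k < n") (auto simp: shift_def e_def q_ge_n)
  qed
  have "[(h \<otimes>\<^bsub>G\<^esub> e i c) k = h k + e i c k + h 0 * shift (e i c) k] (mod q k)"
    using mul_cong by (simp add: mult_G)
  also have "[h k + e i c k + h 0 * shift (e i c) k
      = h k + e i c k + h 0 * e (Suc i) (int p * c) k] (mod q k)"
    by (intro cong_add cong_mult cong_refl sh)
  also have "[h k + e i c k + h 0 * e (Suc i) (int p * c) k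
      = e (Suc i) (int p * h 0 * c) k + (e i c k + h k)] (mod q k)"
  proof (cases "k = Suc i")
    case True
    have "[h 0 * (int p * c mod q (Suc i)) = int p * h 0 * c mod q (Suc i)] (mod q (Suc i))"
      by (simp add: cong_def mod_mult_right_eq mult.left_commute mult.assoc)
    from cong_add[OF cong_refl[of "h k"] this] show ?thesis
      using True by (simp add: e_def add.commute)
  qed (simp add: e_def add.commute)
  also have "[e (Suc i) (int p * h 0 * c) k + (e i c k + h k)
      = e (Suc i) (int p * h 0 * c) k + (e i c \<otimes>\<^bsub>G\<^esub> h) k] (mod q k)"
    using i by (intro cong_add[OF cong_refl cong_sym[OF mult_base[of "e i c" h k]]]) simp
  also have "[e (Suc i) (int p * h 0 * c) k + (e i c \<otimes>\<^bsub>G\<^esub> h) k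
      = (e (Suc i) (int p * h 0 * c) \<otimes>\<^bsub>G\<^esub> (e i c \<otimes>\<^bsub>G\<^esub> h)) k] (mod q k)"
    by (rule cong_sym[OF mult_base]) simp
  finally show "[(h \<otimes>\<^bsub>G\<^esub> e i c) k
    = (e (Suc i) (int p * h 0 * c) \<otimes>\<^bsub>G\<^esub> (e i c \<otimes>\<^bsub>G\<^esub> h)) k] (mod q k)" .
qed (simp_all add: mult_G)

text \<open>By \<open>mult_e_commute\<close> the commutator of \<open>g\<close> with a p-th power of
  v_i is a power of v_{i+1} with exponent divisible by p^2, hence trivial.\<close>

lemma e_p_central:
  assumes "i \<ge> 1" "g \<in> carrier G"
  shows "e i (int p * c) \<otimes>\<^bsub>G\<^esub> g = g \<otimes>\<^bsub>G\<^esub> e i (int p * c)"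
proof -
  have "int p * g 0 * (int p * c) = (int p)\<^sup>2 * (g 0 * c)"
    by (simp add: power2_eq_square)
  hence "[int p * g 0 * (int p * c) = 0] (mod q (Suc i))"
    using q_dvd_p2[of "Suc i"] by (simp only: cong_0_iff dvd_mult2)
  hence "e (Suc i) (int p * g 0 * (int p * c)) = \<one>\<^bsub>G\<^esub>"
    using e_cong[of _ 0 "Suc i"] by simp
  thus ?thesis
    using mult_e_commute[OF assms, of "int p * c"] assms by (simp del: one_G)
qed

lemma coprime_p_q: "\<not> int p dvd c \<Longrightarrow> coprime c (q j)"
  using prime_p prime_imp_coprime[of "int p" c] by (auto simp: q_def coprime_commute)

text \<open>\<open>c\<close> is a unit modulo \<open>q j\<close>, so v_j^c generates the whole
  cyclic factor.\<close>

lemma e_mem_of_not_dvd: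
  assumes "subgroup H G" "e j c \<in> H" "j \<ge> 1" "\<not> int p dvd c"
  shows "e j d \<in> H"
proof -
  obtain y where "[c * y = 1] (mod q j)"
    using cong_solve_coprime_int[OF coprime_p_q[OF assms(4)]] by blast
  hence "[c * y * d = 1 * d] (mod q j)" by (rule cong_scalar_right)
  thus ?thesis
    using e_multiple_mem[OF assms(1-3), of "y * d" d] by (simp add: mult.assoc)
qed

text \<open>The p-th power of v_j has order at most p, so exponents of it that are prime to p can be
  inverted modulo p.\<close>

lemma e_p_multiple_mem:
  assumes "subgroup H G" "e j (int p * c) \<in> H" "j \<ge> 1" "\<not> int p dvd c"
  shows "e j (int p * d) \<in> H"
proof -
  obtain y where "[c * y = 1] (mod int p)"
    using cong_solve_coprime_int[of c "int p"] coprime_p_q[OF assms(4), of 0] by auto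
  hence "[c * y * d = 1 * d] (mod int p)" by (rule cong_scalar_right)
  hence "[int p * (c * y * d) = int p * (1 * d)] (mod q j)" by (rule p_mult_cong_q)
  thus ?thesis
    using e_multiple_mem[OF assms(1-3), of "y * d" "int p * d"] by (simp add: mult.assoc)
qed

lemma eq_e:
  assumes "f \<in> carrier G" "\<And>i. i < n \<Longrightarrow> i \<noteq> j \<Longrightarrow> f i = 0"
  shows "f = e j (f j)"
proof
  fix i
  have "f j mod q j = f j" using assms(1) by (simp add: mem_carrier)
  thus "f i = e j (f j) i"
    using assms carrier_ge_n[OF assms(1), of i] by (cases "i < n") (auto simp: e_def)
qed

lemma not_dvd_coord_0: "f \<in> carrier G \<Longrightarrow> f 0 \<noteq> 0 \<Longrightarrow> \<not> int p dvd f 0"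
  using q_dvd_coord[of f 0] by auto

text \<open>Some power of \<open>h\<close> agrees with a given element in coordinate 0, and the
  quotient lies in the base group, which the \<open>e j 1\<close> generate.\<close>

lemma eq_carrier_of_e_mem:
  assumes H: "subgroup H G" and h: "h \<in> H" "h 0 \<noteq> 0"
    and e: "\<And>j. 1 \<le> j \<Longrightarrow> j < n \<Longrightarrow> e j 1 \<in> H"
  shows "H = carrier G"
proof
  show "H \<subseteq> carrier G" using H by (rule subgroup.subset)
  show "carrier G \<subseteq> H"
  proof
    fix x assume x: "x \<in> carrier G"
    have hG: "h \<in> carrier G" using H h(1) by (rule subgroup.mem_carrier)
    obtain y where y: "[h 0 * y = 1] (mod int p)"
      using cong_solve_coprime_int[of "h 0" "int p"] coprime_p_q[OF not_dvd_coord_0[OF hG h(2)], of 0]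
      by auto
    \<comment> \<open>As \<open>y\<close> inverts \<open>h 0\<close> modulo p, this exponent gives
      \<open>h\<close> to the power \<open>m\<close> the coordinate \<open>x 0\<close>.\<close>
    define m where "m = nat ((y * x 0) mod int p)"
    have pow: "[(h [^]\<^bsub>G\<^esub> k) 0 = int k * h 0] (mod int p)" for k :: nat
    proof (induction k)
      case (Suc k)
      have "[(h [^]\<^bsub>G\<^esub> k \<otimes>\<^bsub>G\<^esub> h) 0 = (h [^]\<^bsub>G\<^esub> k) 0 + h 0] (mod int p)"
        using two_le_n by (simp only: mult_G) (intro mul_cong_p, simp)
      also have "[(h [^]\<^bsub>G\<^esub> k) 0 + h 0 = int k * h 0 + h 0] (mod int p)"
        by (intro cong_add Suc cong_refl)
      finally show ?case by (simp add: algebra_simps)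
    qed simp
    define g where "g = h [^]\<^bsub>G\<^esub> m"
    have gH: "g \<in> H" unfolding g_def by (rule subgroup_pow_closed[OF H h(1)])
    hence gG: "g \<in> carrier G" using H by (metis subgroup.mem_carrier)
    have "[g 0 = int m * h 0] (mod int p)" unfolding g_def by (rule pow)
    also have "[int m * h 0 = (y * x 0) * h 0] (mod int p)"
      using p_gt_1 by (intro cong_scalar_right) (simp add: m_def cong_def)
    also have "(y * x 0) * h 0 = (h 0 * y) * x 0" by simp
    also have "[(h 0 * y) * x 0 = 1 * x 0] (mod int p)"
      using y by (rule cong_scalar_right)
    finally have gx: "[g 0 = x 0] (mod int p)" by simp
    define z where "z = x \<otimes>\<^bsub>G\<^esub> inv\<^bsub>G\<^esub> g"
    have zG: "z \<in> carrier G" using x gG by (simp add: z_def)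
    have "[z 0 = x 0 + (inv\<^bsub>G\<^esub> g) 0] (mod int p)"
      using two_le_n unfolding z_def mult_G by (intro mul_cong_p) simp
    also have "[x 0 + (inv\<^bsub>G\<^esub> g) 0 = g 0 + (- g 0)] (mod int p)"
      using two_le_n by (intro cong_add cong_sym[OF gx] inv_cong_p gG) simp
    finally have "z 0 = 0"
      using q_dvd_coord[OF zG, of 0] by (simp add: cong_0_iff)
    have "z \<in> H"
    proof (rule mem_of_coords_mem[OF H zG \<open>z 0 = 0\<close>])
      fix j assume j: "1 \<le> j" "j < n"
      show "e j (z j) \<in> H"
        using e_multiple_mem[OF H e[OF j] j(1), of "z j" "z j"] by simp
    qed
    moreover have "x = z \<otimes>\<^bsub>G\<^esub> g"
      using x gG by (simp del: one_G add: z_def m_assoc)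
    ultimately show "x \<in> H" using subgroup.m_closed[OF H] gH by metis
  qed
qed

section \<open>Generating a proper subgroup by n - 1 elements\<close>

text \<open>The generators are \<open>h\<close> and at most n - 2 echelon generators
  \<open>T\<close> of \<open>H0\<close>, with coordinate \<open>j\<close> left out. What
  \<open>T\<close> may miss is \<open>D\<close>, the intersection of \<open>H\<close> with the
  cyclic group of v_j, and commutators with \<open>h\<close> recover it.\<close>

lemma generators_of_normalized_base:
  assumes H: "subgroup H G" and h: "h \<in> H" "h 0 \<noteq> 0"
    and gen: "H \<subseteq> generate G (insert h {x \<in> H. x 0 = 0})"
    and j: "2 \<le> j" "j < n" "e (j - 1) 1 \<in> H" "e j 1 \<notin> H"
  shows "\<exists>S\<subseteq>H. finite S \<and> card S \<le> n - 1 \<and> H \<subseteq> generate G S"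
proof -
  define H0 where "H0 = {x \<in> H. x 0 = 0}"
  define D where "D = {x \<in> H0. \<forall>i\<in>{1..<n} - {j}. x i = 0}"
  have HG: "H \<subseteq> carrier G" using H by (rule subgroup.subset)
  hence hG: "h \<in> carrier G" using h by blast
  have H0: "subgroup H0 G"
    using subgroup_0_coord[OF H] by (simp add: H0_def)
  have D: "subgroup D G"
    unfolding D_def by (rule subgroup_coords_eq_0[OF H0]) (simp add: H0_def)
  \<comment> \<open>An exponent prime to p would put \<open>e j 1\<close> into
    \<open>H\<close>.\<close>
  have D_eq: "\<exists>c. x = e j (int p * c)" if x: "x \<in> D" for x
  proof -
    have "x \<in> carrier G" using x HG by (auto simp: D_def H0_def)
    moreover have "x i = 0" if "i < n" "i \<noteq> j" for i
      using x that by (cases "i = 0") (auto simp: D_def H0_def)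
    ultimately have xe: "x = e j (x j)" by (rule eq_e)
    moreover have "e j (x j) \<in> H" using x xe by (auto simp: D_def H0_def)
    hence "int p dvd x j"
      using e_mem_of_not_dvd[OF H, of j "x j" 1] j by auto
    ultimately show ?thesis by (metis dvdE)
  qed
  have "\<exists>T\<subseteq>H0. finite T \<and> card T \<le> card ({1..<n} - {j}) \<and> H0 \<subseteq> generate G (T \<union> D)"
    unfolding D_def by (rule generators_modulo_coords[OF H0]) (simp_all add: H0_def)
  then obtain T where T: "T \<subseteq> H0" "finite T" "card T \<le> card ({1..<n} - {j})"
      "H0 \<subseteq> generate G (T \<union> D)"
    by blast
  have TG: "T \<subseteq> carrier G" using T(1) HG by (auto simp: H0_def)
  define K where "K = generate G (insert h T)"
  have K: "subgroup K G"
    unfolding K_def using hG TG by (intro generate_is_subgroup) simp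
  have hK: "h \<in> K" unfolding K_def by (intro generate.incl) simp
  have central: "d \<otimes>\<^bsub>G\<^esub> x = x \<otimes>\<^bsub>G\<^esub> d" if "d \<in> D" "x \<in> carrier G" for d x
    using D_eq[OF that(1)] e_p_central[of j x] that(2) j(1) by auto
  \<comment> \<open>\<open>e (j - 1) 1\<close> need not lie in the span of \<open>T\<close>; it does
    so up to a factor from \<open>D\<close>.\<close>
  have "e (j - 1) 1 \<in> H0" using j by (simp add: H0_def)
  hence "e (j - 1) 1 \<in> generate G (T \<union> D)" using T(4) by blast
  with central obtain t d where td: "t \<in> generate G T" "d \<in> D" "e (j - 1) 1 = t \<otimes>\<^bsub>G\<^esub> d"
    by (rule generate_Un_central[OF TG D])
  have tK: "t \<in> K" using td(1) mono_generate[of T "insert h T"] by (auto simp: K_def)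
  have tG: "t \<in> carrier G" using tK K by (metis subgroup.mem_carrier)
  have dG: "d \<in> carrier G" using td(2) D by (metis subgroup.mem_carrier)
  \<comment> \<open>\<open>w\<close> is the commutator of \<open>h\<close> with \<open>e (j - 1) 1 = t \<otimes> d\<close>; as \<open>d\<close> is central, it is also
      the commutator of \<open>h\<close> with \<open>t\<close> and hence lies in \<open>K\<close>.\<close>
  define w where "w = e j (int p * h 0)"
  have wG: "w \<in> carrier G" by (simp add: w_def)
  have "h \<otimes>\<^bsub>G\<^esub> (t \<otimes>\<^bsub>G\<^esub> d) = w \<otimes>\<^bsub>G\<^esub> ((t \<otimes>\<^bsub>G\<^esub> d) \<otimes>\<^bsub>G\<^esub> h)"
    using mult_e_commute[of "j - 1" h 1] hG j(1) td(3) by (simp add: w_def)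
  hence "(h \<otimes>\<^bsub>G\<^esub> t) \<otimes>\<^bsub>G\<^esub> d = (w \<otimes>\<^bsub>G\<^esub> (t \<otimes>\<^bsub>G\<^esub> h)) \<otimes>\<^bsub>G\<^esub> d"
    using central[OF td(2) hG] hG tG dG wG by (simp add: m_assoc)
  hence "h \<otimes>\<^bsub>G\<^esub> t = w \<otimes>\<^bsub>G\<^esub> (t \<otimes>\<^bsub>G\<^esub> h)"
    using hG tG dG wG by (simp only: r_cancel m_closed)
  hence "w = (h \<otimes>\<^bsub>G\<^esub> t) \<otimes>\<^bsub>G\<^esub> inv\<^bsub>G\<^esub> (t \<otimes>\<^bsub>G\<^esub> h)"
    using hG tG wG by (simp only: inv_solve_right m_closed)
  hence wK: "w \<in> K"
    using hK tK subgroup.m_closed[OF K] subgroup.m_inv_closed[OF K] by metis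
  \<comment> \<open>The exponent of \<open>w\<close> is p times \<open>h 0\<close>, which is prime
    to p, so the powers of \<open>w\<close> exhaust the p-multiples.\<close>
  have "D \<subseteq> K"
  proof
    fix x assume "x \<in> D"
    then obtain c where "x = e j (int p * c)" using D_eq by blast
    thus "x \<in> K"
      using e_p_multiple_mem[OF K, of j "h 0" c] wK j(1) not_dvd_coord_0[OF hG h(2)]
      by (simp add: w_def)
  qed
  moreover have "T \<subseteq> K" unfolding K_def by (auto intro: generate.incl)
  ultimately have "H0 \<subseteq> K"
    using T(4) generate_subgroup_incl[OF _ K, of "T \<union> D"] by blast
  hence "H \<subseteq> K"
    using gen hK generate_subgroup_incl[OF _ K, of "insert h H0"] by (auto simp: H0_def)
  moreover have "card (insert h T) \<le> n - 1"
    using T(2,3) j by (auto simp: card_insert_if)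
  moreover have "insert h T \<subseteq> H" using T(1) h(1) by (auto simp: H0_def)
  ultimately show ?thesis using T(2) unfolding K_def by blast
qed

lemma proper_subgroup_generators:
  assumes H: "subgroup H G" "H \<noteq> carrier G"
  shows "\<exists>S\<subseteq>H. finite S \<and> card S \<le> n - 1 \<and> H \<subseteq> generate G S"
proof -
  define H0 where "H0 = {x \<in> H. x 0 = 0}"
  have HG: "H \<subseteq> carrier G" using H(1) by (rule subgroup.subset)
  have H0: "subgroup H0 G"
    using subgroup_0_coord[OF H(1)] by (simp add: H0_def)
  have H0_echelon: "\<exists>T\<subseteq>H0. finite T \<and> card T \<le> card I \<and>
      H0 \<subseteq> generate G (T \<union> {x \<in> H0. \<forall>i\<in>I. x i = 0})" if "finite I" for I
    by (rule generators_modulo_coords[OF H0 _ that]) (simp add: H0_def)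
  \<comment> \<open>When the part not reached by the echelon generators is trivial, they generate
    \<open>H0\<close> alone.\<close>
  have absorb: "H0 \<subseteq> generate G T"
    if T: "T \<subseteq> H0" "H0 \<subseteq> generate G (T \<union> D)" "D \<subseteq> {\<lambda>_. 0}" for T D
  proof -
    have "subgroup (generate G T) G"
      using T(1) HG by (intro generate_is_subgroup) (auto simp: H0_def)
    moreover have "T \<union> D \<subseteq> generate G T"
      using T(3) generate.one[of G T] by (auto intro: generate.incl)
    ultimately show ?thesis using T(2) generate_subgroup_incl by blast
  qed
  \<comment> \<open>Coordinate 0 is a homomorphism modulo p whose kernel on \<open>H\<close> is
    \<open>H0\<close>.\<close>
  obtain h where h: "h \<in> H" "H \<subseteq> generate G (insert h {x \<in> H. int p dvd x 0})"
  proof (rule generate_cyclic_quotient[OF H(1), of "int p" "\<lambda>x. x 0"])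
    show "[(x \<otimes>\<^bsub>G\<^esub> y) 0 = x 0 + y 0] (mod int p)" for x y
      using two_le_n by (simp only: mult_G) (intro mul_cong_p, simp)
  qed (use p_gt_1 in auto)
  have "{x \<in> H. int p dvd x 0} = H0"
    using q_dvd_coord[of _ 0] HG by (auto simp: H0_def)
  with h have gen: "H \<subseteq> generate G (insert h H0)" by simp
  show ?thesis
  proof (cases "h 0 = 0")
    \<comment> \<open>Here \<open>H\<close> lies in the base group, and eliminating its n - 1
      coordinates leaves nothing.\<close>
    case True
    hence "insert h H0 = H0" using h(1) by (auto simp: H0_def)
    hence "H \<subseteq> H0" using gen generate_subgroup_incl[OF subset_refl H0] by simp
    obtain T where T: "T \<subseteq> H0" "finite T" "card T \<le> card {1..<n}"
        "H0 \<subseteq> generate G (T \<union> {x \<in> H0. \<forall>i\<in>{1..<n}. x i = 0})"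
      using H0_echelon[of "{1..<n}"] by auto
    have "x = (\<lambda>_. 0)" if x: "x \<in> H0" "\<forall>i\<in>{1..<n}. x i = 0" for x
    proof -
      have "x = e 0 (x 0)" using x HG by (intro eq_e) (auto simp: H0_def)
      also have "\<dots> = (\<lambda>_. 0)" using x by (simp add: H0_def)
      finally show ?thesis .
    qed
    hence "H0 \<subseteq> generate G T" by (intro absorb[OF T(1,4)]) auto
    thus ?thesis using T \<open>H \<subseteq> H0\<close> by (intro exI[of _ T]) (auto simp: H0_def)
  next
    case h0: False
    \<comment> \<open>The intersection of \<open>H\<close> with the cyclic group of v_1. If it is
      trivial, n - 2 echelon generators and \<open>h\<close> suffice.\<close>
    define D where "D = {x \<in> H0. \<forall>i\<in>{2..<n}. x i = 0}"
    show ?thesis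
    proof (cases "D \<subseteq> {\<lambda>_. 0}")
      case True
      obtain T where T: "T \<subseteq> H0" "finite T" "card T \<le> card {2..<n}"
          "H0 \<subseteq> generate G (T \<union> D)"
        using H0_echelon[of "{2..<n}"] unfolding D_def by auto
      have H0T: "H0 \<subseteq> generate G T" by (rule absorb[OF T(1,4) True])
      have "subgroup (generate G (insert h T)) G"
        using T(1) h(1) HG by (intro generate_is_subgroup) (auto simp: H0_def)
      moreover have "insert h H0 \<subseteq> generate G (insert h T)"
        using H0T mono_generate[of T "insert h T"] generate.incl[of h "insert h T"] by blast
      ultimately have "H \<subseteq> generate G (insert h T)"
        using gen generate_subgroup_incl by blast
      moreover have "card (insert h T) \<le> n - 1"
        using T(2,3) two_le_n by (auto simp: card_insert_if)
      moreover have "insert h T \<subseteq> H" using T(1) h(1) by (auto simp: H0_def)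
      ultimately show ?thesis using T(2) by blast
    next
      case False
      \<comment> \<open>v_1 has prime order, so a nontrivial element of its cyclic group already
        puts v_1 into \<open>H\<close>.\<close>
      then obtain x where x: "x \<in> D" "x \<noteq> (\<lambda>_. 0)" by auto
      have xG: "x \<in> carrier G" using x(1) HG by (auto simp: D_def H0_def)
      moreover have "x i = 0" if "i < n" "i \<noteq> 1" for i
        using x(1) that by (cases "i = 0") (auto simp: D_def H0_def)
      ultimately have xe: "x = e 1 (x 1)" by (rule eq_e)
      hence "x 1 \<noteq> 0" using x(2) by auto
      hence "\<not> int p dvd x 1" using q_dvd_coord[OF xG, of 1] by auto
      moreover have "e 1 (x 1) \<in> H" using x(1) xe by (auto simp: D_def H0_def)
      ultimately have "e 1 1 \<in> H" using e_mem_of_not_dvd[OF H(1)] by simp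
      \<comment> \<open>Otherwise \<open>H\<close>, which contains \<open>h\<close> outside the base
        group, would be everything. The least such \<open>j\<close> exceeds 1, so v_{j-1} lies in
        \<open>H\<close>.\<close>
      have "\<exists>j. 1 \<le> j \<and> j < n \<and> e j 1 \<notin> H"
        using eq_carrier_of_e_mem[OF H(1) h(1) h0] H(2) by blast
      then obtain j where j: "1 \<le> j" "j < n" "e j 1 \<notin> H"
        and least: "\<And>i. i < j \<Longrightarrow> 1 \<le> i \<Longrightarrow> e i 1 \<in> H"
        using exists_least_iff[of "\<lambda>j. 1 \<le> j \<and> j < n \<and> e j 1 \<notin> H"] by force
      have "j \<noteq> 1" using \<open>e 1 1 \<in> H\<close> j(3) by blast
      hence "2 \<le> j" "e (j - 1) 1 \<in> H" using j(1) least[of "j - 1"] by auto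
      thus ?thesis
        using generators_of_normalized_base[OF H(1) h(1) h0] gen j by (simp add: H0_def)
    qed
  qed
qed

section \<open>The lower bound n for the number of generators\<close>

text \<open>Multiplication is additive modulo p, so generated elements reduce to linear combinations
  of \<open>S\<close>, with the same coefficients in every coordinate.\<close>

lemma coords_mod_p_of_generate:
  assumes S: "S \<subseteq> carrier G" "finite S" and x: "x \<in> generate G S"
  shows "\<exists>c. \<forall>k<n. [x k = (\<Sum>s\<in>S. c s * s k)] (mod int p)"
  using x
proof (induction rule: generate.induct)
  case one
  show ?case by (intro exI[of _ "\<lambda>_. 0"]) simp
next
  case (incl x)
  have "(\<Sum>s\<in>S. (if s = x then 1 else 0) * s k) = x k" for k
    using incl S(2) by (simp add: if_distrib[of "\<lambda>c. c * _"] cong: if_cong)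
  thus ?case by (intro exI[of _ "\<lambda>s. if s = x then 1 else 0"]) simp
next
  case (inv x)
  have "(\<Sum>s\<in>S. (if s = x then - 1 else 0) * s k) = - x k" for k
    using inv S(2) by (simp add: if_distrib[of "\<lambda>c. c * _"] cong: if_cong)
  thus ?case
    using inv_cong_p inv S(1) by (intro exI[of _ "\<lambda>s. if s = x then - 1 else 0"]) auto
next
  case (eng x y)
  then obtain c d where
    cd: "\<forall>k<n. [x k = (\<Sum>s\<in>S. c s * s k)] (mod int p)"
      "\<forall>k<n. [y k = (\<Sum>s\<in>S. d s * s k)] (mod int p)" by blast
  have "[(x \<otimes>\<^bsub>G\<^esub> y) k = (\<Sum>s\<in>S. (c s + d s) * s k)] (mod int p)" if "k < n" for k
  proof -
    have "[(x \<otimes>\<^bsub>G\<^esub> y) k = x k + y k] (mod int p)"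
      unfolding mult_G using that by (rule mul_cong_p)
    also have "[x k + y k = (\<Sum>s\<in>S. c s * s k) + (\<Sum>s\<in>S. d s * s k)] (mod int p)"
      using cd that by (intro cong_add) auto
    finally show ?thesis by (simp add: distrib_right sum.distrib)
  qed
  thus ?case by (intro exI[of _ "\<lambda>s. c s + d s"]) blast
qed

text \<open>All p^n vectors modulo p must arise from coefficient families on \<open>S\<close>, of
  which there are p to the power \<open>card S\<close>.\<close>

lemma card_generators_ge:
  assumes S: "S \<subseteq> carrier G" "finite S" and gen: "generate G S = carrier G"
  shows "n \<le> card S"
proof -
  define F where "F c = (\<lambda>k\<in>{..<n}. (\<Sum>s\<in>S. c s * s k) mod int p)" for c :: "(nat \<Rightarrow> int) \<Rightarrow> int"
  have "PiE {..<n} (\<lambda>_. {0..<int p}) \<subseteq> F ` PiE S (\<lambda>_. {0..<int p})"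
  proof
    fix y assume y: "y \<in> PiE {..<n} (\<lambda>_. {0..<int p})"
    \<comment> \<open>Entries below p are reduced for every modulus \<open>q k\<close> with
      \<open>k < n\<close>, so \<open>y\<close> padded with zeros is an element of the
      group.\<close>
    define x where "x k = (if k < n then y k else 0)" for k
    have "int p \<le> q k" if "k < n" for k
      using zdvd_imp_le[OF p_dvd_q[OF that]] by simp
    hence "x \<in> carrier G"
      using y by (force simp: mem_carrier x_def PiE_iff)
    then obtain c where c: "\<forall>k<n. [x k = (\<Sum>s\<in>S. c s * s k)] (mod int p)"
      using coords_mod_p_of_generate[OF S] gen by blast
    define c' where "c' = (\<lambda>s\<in>S. c s mod int p)"
    have "F c' k = y k" if "k < n" for k
    proof -
      have "F c' k = (\<Sum>s\<in>S. (c s mod int p) * s k) mod int p"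
        using that by (simp add: F_def c'_def)
      also have "\<dots> = (\<Sum>s\<in>S. c s * s k) mod int p"
        unfolding cong_def[symmetric]
        by (intro cong_sum cong_mult cong_refl) (simp add: cong_def)
      also have "\<dots> = x k mod int p" using c that by (simp add: cong_def)
      also have "\<dots> = y k" using y that by (simp add: x_def PiE_iff)
      finally show ?thesis .
    qed
    hence "F c' = y"
      using y by (intro PiE_ext[of _ "{..<n}" "\<lambda>_. UNIV"]) (auto simp: F_def PiE_iff)
    moreover have "c' \<in> PiE S (\<lambda>_. {0..<int p})"
      using p_gt_1 by (auto simp: c'_def)
    ultimately show "y \<in> F ` PiE S (\<lambda>_. {0..<int p})" by blast
  qed
  hence "card (PiE {..<n} (\<lambda>_. {0..<int p})) \<le> card (PiE S (\<lambda>_. {0..<int p}))"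
    using S(2) by (intro surj_card_le finite_PiE) auto
  hence "p ^ n \<le> p ^ card S" using S(2) by (simp add: card_PiE)
  thus ?thesis using p_gt_1 by simp
qed

section \<open>The order of the group and its derived subgroup\<close>

lemma carrier_eq: "carrier G = {f. (\<forall>k<n. f k \<in> {0..<q k}) \<and> (\<forall>k\<ge>n. f k = 0)}"
proof (rule Set.set_eqI, rule iffI)
  fix f assume "f \<in> carrier G"
  thus "f \<in> {f. (\<forall>k<n. f k \<in> {0..<q k}) \<and> (\<forall>k\<ge>n. f k = 0)}"
    using carrier_ge_n by (auto simp: mem_carrier)
next
  fix f assume f: "f \<in> {f. (\<forall>k<n. f k \<in> {0..<q k}) \<and> (\<forall>k\<ge>n. f k = 0)}"
  have "0 \<le> f k \<and> f k < q k" for k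
    using f by (cases "k < n") auto
  thus "f \<in> carrier G" by (simp add: mem_carrier)
qed

text \<open>Separates the two coordinates with modulus p from the n - 2 coordinates with modulus
  p^2.\<close>

lemma prod_split: "(\<Prod>k<n. F k) = F 0 * F 1 * (\<Prod>k\<in>{2..<n}. F k)"
  for F :: "nat \<Rightarrow> nat"
proof -
  have "{..<n} = insert 0 (insert 1 {2..<n})" using two_le_n by auto
  thus ?thesis by simp
qed

lemma finite_carrier: "finite (carrier G)"
  unfolding carrier_eq by (rule finite_card_functions) simp

lemma order_G: "order G = p ^ (2 * n - 2)"
proof -
  have "order G = (\<Prod>k<n. card {0..<q k})"
    unfolding order_def carrier_eq by (rule finite_card_functions) simp
  also have "\<dots> = p * p * (\<Prod>k\<in>{2..<n}. p\<^sup>2)"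
    unfolding prod_split by (simp add: q_def nat_power_eq)
  also have "\<dots> = p ^ (2 + 2 * (n - 2))" by (simp add: power_add power2_eq_square power_mult)
  also have "2 + 2 * (n - 2) = 2 * n - 2" using two_le_n by simp
  finally show ?thesis .
qed

lemma subgroup_p_dvd_coords: "subgroup {f \<in> carrier G. \<forall>k<n. int p dvd f k} G" (is "subgroup ?D G")
proof (rule subgroupI)
  show "?D \<noteq> {}" using one_closed by force
next
  fix f assume f: "f \<in> ?D"
  hence "int p dvd (inv\<^bsub>G\<^esub> f) k" if "k < n" for k
    using cong_dvd_iff[OF inv_cong_p[of f k]] that by simp
  thus "inv\<^bsub>G\<^esub> f \<in> ?D" using f by simp
next
  fix f g assume fg: "f \<in> ?D" "g \<in> ?D"
  hence "int p dvd mul f g k" if "k < n" for k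
    using cong_dvd_iff[OF mul_cong_p[of k f g]] that by simp
  thus "f \<otimes>\<^bsub>G\<^esub> g \<in> ?D" by (simp add: mult_G)
qed auto

text \<open>It is the commutator of \<open>e 0 1\<close> with \<open>e (j - 1) 1\<close>.\<close>

lemma e_p_mem_derived:
  assumes "2 \<le> j"
  shows "e j (int p) \<in> derived G (carrier G)"
proof -
  define a where "a = e (j - 1) 1"
  have aG: "a \<in> carrier G" and hG: "e 0 1 \<in> carrier G" by (simp_all add: a_def)
  have "e 0 1 \<otimes>\<^bsub>G\<^esub> a = e j (int p) \<otimes>\<^bsub>G\<^esub> (a \<otimes>\<^bsub>G\<^esub> e 0 1)"
    using mult_e_commute[of "j - 1" "e 0 1" 1] assms p_gt_1 by (simp add: a_def e_def)
  hence "e j (int p) = (e 0 1 \<otimes>\<^bsub>G\<^esub> a) \<otimes>\<^bsub>G\<^esub> inv\<^bsub>G\<^esub> (a \<otimes>\<^bsub>G\<^esub> e 0 1)"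
    using aG hG by (simp only: inv_solve_right m_closed e_closed)
  also have "\<dots> = e 0 1 \<otimes>\<^bsub>G\<^esub> a \<otimes>\<^bsub>G\<^esub> inv\<^bsub>G\<^esub> (e 0 1) \<otimes>\<^bsub>G\<^esub> inv\<^bsub>G\<^esub> a"
    using aG hG by (simp only: inv_mult_group m_assoc m_closed inv_closed)
  finally show ?thesis
    unfolding derived_def using aG hG by (intro generate.incl) blast
qed

text \<open>Commutators vanish modulo p because reduction modulo p is a homomorphism to an abelian
  group. Conversely, such an \<open>f\<close> is a product of powers of the commutators
  \<open>e j (int p)\<close> with \<open>2 \<le> j\<close>.\<close>

lemma derived_G: "derived G (carrier G) = {f \<in> carrier G. \<forall>k<n. int p dvd f k}" (is "_ = ?D")
proof
  have "derived_set G (carrier G) \<subseteq> ?D"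
  proof clarify
    fix f g assume fg: "f \<in> carrier G" "g \<in> carrier G"
    have "int p dvd (f \<otimes>\<^bsub>G\<^esub> g \<otimes>\<^bsub>G\<^esub> inv\<^bsub>G\<^esub> f \<otimes>\<^bsub>G\<^esub> inv\<^bsub>G\<^esub> g) k" if k: "k < n" for k
    proof -
      note hom = mul_cong_p[OF k, folded mult_G]
      have "[(f \<otimes>\<^bsub>G\<^esub> g \<otimes>\<^bsub>G\<^esub> inv\<^bsub>G\<^esub> f \<otimes>\<^bsub>G\<^esub> inv\<^bsub>G\<^esub> g) k
          = (f \<otimes>\<^bsub>G\<^esub> g \<otimes>\<^bsub>G\<^esub> inv\<^bsub>G\<^esub> f) k + (inv\<^bsub>G\<^esub> g) k] (mod int p)"
        by (rule hom)
      also have "[(f \<otimes>\<^bsub>G\<^esub> g \<otimes>\<^bsub>G\<^esub> inv\<^bsub>G\<^esub> f) k + (inv\<^bsub>G\<^esub> g) k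
          = (f \<otimes>\<^bsub>G\<^esub> g) k + (inv\<^bsub>G\<^esub> f) k + - g k] (mod int p)"
        using fg k by (intro cong_add hom inv_cong_p)
      also have "[(f \<otimes>\<^bsub>G\<^esub> g) k + (inv\<^bsub>G\<^esub> f) k + - g k = f k + g k + - f k + - g k] (mod int p)"
        using fg k by (intro cong_add hom inv_cong_p cong_refl)
      finally show ?thesis by (simp add: cong_0_iff)
    qed
    thus "f \<otimes>\<^bsub>G\<^esub> g \<otimes>\<^bsub>G\<^esub> inv\<^bsub>G\<^esub> f \<otimes>\<^bsub>G\<^esub> inv\<^bsub>G\<^esub> g \<in> carrier G \<and>
        (\<forall>k<n. int p dvd (f \<otimes>\<^bsub>G\<^esub> g \<otimes>\<^bsub>G\<^esub> inv\<^bsub>G\<^esub> f \<otimes>\<^bsub>G\<^esub> inv\<^bsub>G\<^esub> g) k)"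
      using fg by (simp del: one_G)
  qed
  thus "derived G (carrier G) \<subseteq> ?D"
    unfolding derived_def using subgroup_p_dvd_coords by (rule generate_subgroup_incl)
next
  show "?D \<subseteq> derived G (carrier G)"
  proof
    fix f assume f: "f \<in> ?D"
    have der: "subgroup (derived G (carrier G)) G"
      by (rule derived_is_subgroup[OF subset_refl])
    \<comment> \<open>Coordinates 0 and 1 have modulus p, so divisibility by p forces them to be
      0.\<close>
    have low: "f k = 0" if "k < 2" for k
      using q_dvd_coord[of f k] f that two_le_n by (simp add: q_def)
    have coords: "e j (f j) \<in> derived G (carrier G)" if j: "1 \<le> j" "j < n" for j
    proof (cases "j = 1")
      case True
      thus ?thesis using low[of 1] subgroup.one_closed[OF der] by simp
    next
      case False
      obtain c where "f j = int p * c" using f j by (auto elim: dvdE)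
      thus ?thesis
        using e_multiple_mem[OF der e_p_mem_derived, of j c "f j"] j False by simp
    qed
    have "f \<in> carrier G" "f 0 = 0" using f low[of 0] by simp_all
    thus "f \<in> derived G (carrier G)" using coords by (rule mem_of_coords_mem[OF der])
  qed
qed

lemma card_derived_G: "card (derived G (carrier G)) = p ^ (n - 2)"
proof -
  \<comment> \<open>The values allowed in coordinate \<open>k\<close> of the derived subgroup: only
    0 for \<open>k < 2\<close>, and the p multiples of p below p^2 for the other
    \<open>k < n\<close>.\<close>
  define B where "B k = {x \<in> {0..<q k}. int p dvd x}" for k
  have finite_B: "finite (B k)" for k
    unfolding B_def by (rule finite_subset[of _ "{0..<q k}"]) auto
  have "derived G (carrier G) = {f. (\<forall>k<n. f k \<in> B k) \<and> (\<forall>k\<ge>n. f k = 0)}"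
    by (subst derived_G) (auto simp: carrier_eq B_def)
  hence "card (derived G (carrier G)) = (\<Prod>k<n. card (B k))"
    using finite_card_functions(2)[of n B 0] finite_B by simp
  also have "card (B k) = 1" if "k < 2" for k
  proof -
    have "x = 0" if "0 \<le> x" "x < int p" "int p dvd x" for x
      using that zdvd_not_zless[of x "int p"] by linarith
    hence "B k = {0}"
      using that p_gt_1 by (auto simp: B_def q_def)
    thus ?thesis by simp
  qed
  hence "(\<Prod>k<n. card (B k)) = (\<Prod>k\<in>{2..<n}. card (B k))"
    unfolding prod_split by simp
  also have "card (B k) = p" if "k \<in> {2..<n}" for k
  proof -
    have "x \<in> (\<lambda>x. int p * x) ` {0..<int p}" if x: "0 \<le> x" "x < int p * int p" "int p dvd x" for x
    proof -
      obtain y where y: "x = int p * y" using x(3) by (rule dvdE)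
      hence "0 \<le> y" "y < int p" using x(1,2) p_gt_1 by (simp_all add: zero_le_mult_iff)
      thus ?thesis using y by auto
    qed
    hence "B k = (\<lambda>x. int p * x) ` {0..<int p}"
      using that p_gt_1 by (auto simp: B_def q_def power2_eq_square)
    moreover have "inj_on (\<lambda>x. int p * x) {0..<int p}" using p_gt_1 by (simp add: inj_on_def)
    ultimately show ?thesis by (simp add: card_image)
  qed
  hence "(\<Prod>k\<in>{2..<n}. card (B k)) = p ^ (n - 2)" by simp
  finally show ?thesis .
qed

section \<open>Maximality and transport to the natural numbers\<close>

lemma d_maximal_G: "d_maximal G"
proof -
  have ge: "n \<le> min_gen_card G"
    using card_generators_ge finite_subset[OF _ finite_carrier]
    by (intro min_gen_card_ge finite_carrier) blast
  have "min_gen_card (G\<lparr>carrier := H\<rparr>) < min_gen_card G"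
    if H: "subgroup H G" "H \<noteq> carrier G" for H
  proof -
    obtain S where "S \<subseteq> H" "finite S" "card S \<le> n - 1" "H \<subseteq> generate G S"
      using proper_subgroup_generators[OF H] by blast
    hence "min_gen_card (G\<lparr>carrier := H\<rparr>) \<le> n - 1"
      using min_gen_card_subgroup_le[OF H(1)] by force
    thus ?thesis using ge two_le_n by linarith
  qed
  thus ?thesis using finite_carrier is_group by (simp add: d_maximal_def)
qed

end

theorem theorem1p2:
  fixes p n :: nat
  assumes "Factorial_Ring.prime p" and "n \<ge> 2"
  shows "\<exists>G :: nat monoid. finite_p_group p G \<and> d_maximal G \<and>
           card (rcosets\<^bsub>G\<^esub> (derived G (carrier G))) = p ^ n \<and>
           card (derived G (carrier G)) = p ^ (n - 2)"
proof -
  interpret S: shift_extension p n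
    using assms by unfold_locales
  obtain G :: "nat monoid" and \<phi> where G: "group G" and iso: "\<phi> \<in> iso S.G G"
    using S.finite_iso_nat[OF S.finite_carrier] by blast
  interpret \<phi>: group_hom S.G G \<phi>
    using G iso S.is_group by (auto simp: group_hom_def group_hom_axioms_def iso_def)
  have inj: "inj_on \<phi> (carrier S.G)" and im: "\<phi> ` carrier S.G = carrier G"
    using iso by (auto simp: iso_def bij_betw_def)
  have order: "order G = p ^ (2 * n - 2)"
    using card_image[OF inj] S.order_G by (simp add: order_def im)
  have "derived G (carrier G) = \<phi> ` derived S.G (carrier S.G)"
    using \<phi>.derived_img[of "carrier S.G"] im by simp
  hence der: "card (derived G (carrier G)) = p ^ (n - 2)"
    using S.card_derived_G card_image[OF inj_on_subset[OF inj S.derived_in_carrier[OF subset_refl]]]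
    by simp
  \<comment> \<open>Lagrange gives the index as the quotient of the two known orders.\<close>
  have "card (rcosets\<^bsub>G\<^esub> derived G (carrier G)) * p ^ (n - 2) = p ^ (2 * n - 2)"
    using \<phi>.H.lagrange[OF \<phi>.H.derived_is_subgroup[OF subset_refl]] order der by simp
  also have "2 * n - 2 = n + (n - 2)"
    using assms(2) by simp
  finally have "card (rcosets\<^bsub>G\<^esub> derived G (carrier G)) = p ^ n"
    using S.p_gt_1 by (simp add: power_add)
  moreover have "finite (carrier G)"
    using S.finite_carrier im by (metis finite_imageI)
  hence "finite_p_group p G"
    using G order by (auto simp: finite_p_group_def)
  ultimately show ?thesis
    using der iso_d_maximal[OF S.d_maximal_G G iso] by blast
qed

end
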